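(* For Lebesgue-almost all $s\in[0,1]$, $u'(s) = 0$.
   Context: Let $M_0 = \frac{1}{5}\begin{pmatrix} 5 & 2 & 2\\ 0 & 2 & 1\\ 0 & 1 & 2 \end{pmatrix}$ and $M_1 = \frac{1}{5}\begin{pmatrix} 2 & 0 & 1\\ 2 & 5 & 2\\ 1 & 0 & 2 \end{pmatrix}$, and let $h_0(x) = \frac{x}{2}$, $h_1(x) = \frac{x+1}{2}$. Let $u:[0,1]\to\mathbb{R}^3$ be the unique continuous function satisfying $u(0) = (1,0,0)^T$, $u(1) = (0,1,0)^T$, $u\circ h_0 = M_0\circ u$ and $u \circ h_1 = M_1\circ u$ on $[0,1]$ (this function is known to exist and to be unique). The derivative $u'(s)$ is the limit of $\frac{u(t)-u(s)}{t-s}$ as $t\to s$, $t\in[0,1]\setminus\{s\}$. *)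

theory Defs
  imports "HOL-Analysis.Analysis"
begin

definition M0 :: "real^3^3" where
  "M0 = (1/5) *\<^sub>R vector [vector [5, 2, 2],
                           vector [0, 2, 1],
                           vector [0, 1, 2]]"

definition M1 :: "real^3^3" where
  "M1 = (1/5) *\<^sub>R vector [vector [2, 0, 1],
                           vector [2, 5, 2],
                           vector [1, 0, 2]]"

definition h0 :: "real \<Rightarrow> real" where "h0 x = x / 2"

definition h1 :: "real \<Rightarrow> real" where "h1 x = (x + 1) / 2"

(* Only the values of u on {0..1} are constrained: a function on [0,1] is
   represented by any of its extensions to the real line. *)
definition is_curve :: "(real \<Rightarrow> real^3) \<Rightarrow> bool" where
  "is_curve u \<longleftrightarrow>
     continuous_on {0..1} u \<and>
     u 0 = vector [1, 0, 0] \<and> u 1 = vector [0, 1, 0] \<and>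
     (\<forall>x\<in>{0..1}. u (h0 x) = M0 *v u x) \<and>
     (\<forall>x\<in>{0..1}. u (h1 x) = M1 *v u x)"

end

theory Submission imports Defs begin

text \<open>
  On the \<open>k\<close>-th dyadic interval of level \<open>n\<close> the curve is a linear image of itself: its restriction
  is \<open>A *v u x\<close> with \<open>x\<close> running over \<open>[0,1]\<close>, where \<open>A\<close> is a product of \<open>n\<close> factors \<open>M0\<close>, \<open>M1\<close> (lemma
  \<open>curve_on_cell\<close>). So the derivative vanishes almost everywhere as soon as, for almost every \<open>s\<close>, the
  oscillation of \<open>u\<close> over the intervals of level \<open>n\<close> close to \<open>s\<close> is \<open>o(2^-n)\<close>.

  The coordinates of \<open>u\<close> always add up to 1, hence increments of \<open>u\<close> lie in the plane of vectors with
  coordinate sum 0. This plane is spanned by the total increment \<open>chord\<close> and by a second vector \<open>bend\<close>;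
  in this basis both matrices are simple. The first coordinate of \<open>u\<close> decreases
  and the second one increases, which appears here as an invariant cone (lemma \<open>cell_matrix_cone\<close>).
  Consequently the increment of \<open>u$2 - u$1\<close> over an interval, called its \<open>mass\<close>, is positive and controls
  the whole oscillation of \<open>u\<close> there (lemma \<open>oscillation_le_mass\<close>).

  The masses of the two halves of an interval add up to its mass, but their ratio is in general not 1:
  it is governed by \<open>skew / mass\<close>. Since the square root is strictly concave, the sum of the
  square roots of the \<open>2^n\<close> masses therefore grows at a strictly smaller exponential rate than \<open>sqrt 2^n\<close>,
  the rate for equal masses (lemmas \<open>weight_contraction\<close> and \<open>sum_weight_le\<close>). By Markov's inequality only an
  exponentially small fraction of the intervals has a mass above \<open>\<theta>^(2*n) / 2^n\<close>, where \<open>\<theta> < 1\<close> (lemma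
  \<open>card_heavy_le\<close>). By Borel and Cantelli almost every \<open>s\<close> eventually stays away from those
  intervals and from their neighbours (lemma \<open>AE_avoids_heavy\<close>), and at every such \<open>s\<close> the difference quotients
  at scale \<open>2^-n\<close> are \<open>O(\<theta>^(2*n))\<close>.
\<close>

section \<open>Self-similarity on dyadic intervals\<close>

text \<open>
  The binary digits of \<open>k\<close> say which halves have been chosen. The last digit, the finest subdivision,
  belongs to the rightmost factor, since that matrix acts first.
\<close>
fun cell_matrix :: "nat \<Rightarrow> nat \<Rightarrow> real^3^3" where
  "cell_matrix 0 k = mat 1"
| "cell_matrix (Suc n) k = cell_matrix n (k div 2) ** (if even k then M0 else M1)"

definition cell :: "nat \<Rightarrow> nat \<Rightarrow> real set" where
  "cell n k = {real k / 2^n .. (real k + 1) / 2^n}"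

lemma M0_mult: "M0 *v v = vector [v$1 + 2/5 * v$2 + 2/5 * v$3, 2/5 * v$2 + 1/5 * v$3, 1/5 * v$2 + 2/5 * v$3]"
  by (simp add: M0_def vec_eq_iff forall_3 matrix_vector_mult_def sum_3 field_simps)

lemma M1_mult: "M1 *v v = vector [2/5 * v$1 + 1/5 * v$3, 2/5 * v$1 + v$2 + 2/5 * v$3, 1/5 * v$1 + 2/5 * v$3]"
  by (simp add: M1_def vec_eq_iff forall_3 matrix_vector_mult_def sum_3 field_simps)

lemma curve_on_cell:
  assumes "is_curve u" "k < 2^n" "x \<in> {0..1}"
  shows "u ((real k + x) / 2^n) = cell_matrix n k *v u x"
  using assms(2,3)
proof (induction n arbitrary: k x)
  case 0
  then show ?case by simp
next
  case (Suc n)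
  have k2: "k div 2 < 2^n" using Suc.prems(1) by auto
  show ?case
  proof (cases "even k")
    case True
    then have "real k = 2 * real (k div 2)" by auto
    then have eq: "(real k + x) / 2^Suc n = (real (k div 2) + h0 x) / 2^n"
      by (simp add: h0_def field_simps)
    have "h0 x \<in> {0..1}" using Suc.prems(2) by (auto simp: h0_def)
    then have "u ((real k + x) / 2^Suc n) = cell_matrix n (k div 2) *v u (h0 x)"
      unfolding eq using Suc.IH[OF k2] by blast
    also have "u (h0 x) = M0 *v u x" using assms(1) Suc.prems(2) by (auto simp: is_curve_def)
    finally show ?thesis using True by (simp add: matrix_vector_mul_assoc)
  next
    case False
    then obtain m where m: "k = 2 * m + 1" by (auto elim: oddE)
    then have eq: "(real k + x) / 2^Suc n = (real (k div 2) + h1 x) / 2^n"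
      by (simp add: h1_def field_simps)
    have "h1 x \<in> {0..1}" using Suc.prems(2) by (auto simp: h1_def)
    then have "u ((real k + x) / 2^Suc n) = cell_matrix n (k div 2) *v u (h1 x)"
      unfolding eq using Suc.IH[OF k2] by blast
    also have "u (h1 x) = M1 *v u x" using assms(1) Suc.prems(2) by (auto simp: is_curve_def)
    finally show ?thesis using False by (simp add: matrix_vector_mul_assoc)
  qed
qed

section \<open>An invariant cone\<close>

text \<open>
  \<open>chord\<close> is \<open>u 1 - u 0\<close>. The second basis vector is chosen as \<open>10 * (M0 *v chord - chord / 2)\<close>, so that it
  measures how far the increment over the left half is from half of the total increment.
\<close>
definition chord :: "real^3" where "chord = vector [-1, 1, 0]"
definition bend :: "real^3" where "bend = vector [-1, -1, 2]"

lemma M0_chord: "M0 *v chord = (1/2) *\<^sub>R chord + (1/10) *\<^sub>R bend"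
  and M0_bend: "M0 *v bend = (3/10) *\<^sub>R chord + (3/10) *\<^sub>R bend"
  and M1_chord: "M1 *v chord = (1/2) *\<^sub>R chord - (1/10) *\<^sub>R bend"
  and M1_bend: "M1 *v bend = (3/10) *\<^sub>R bend - (3/10) *\<^sub>R chord"
  by (simp_all add: M0_mult M1_mult chord_def bend_def vec_eq_iff forall_3)

lemma cell_matrix_step:
  fixes n k :: nat
  defines "P \<equiv> cell_matrix n (k div 2) *v chord" and "Q \<equiv> cell_matrix n (k div 2) *v bend"
  shows "cell_matrix (Suc n) k *v chord = (1/2) *\<^sub>R P + (if even k then 1/10 else -1/10) *\<^sub>R Q"
    and "cell_matrix (Suc n) k *v bend = (3/10) *\<^sub>R Q + (if even k then 3/10 else -3/10) *\<^sub>R P"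
  unfolding P_def Q_def
  by (auto simp: matrix_vector_mul_assoc[symmetric] M0_chord M0_bend M1_chord M1_bend
      matrix_vector_right_distrib matrix_vector_mult_diff_distrib scaleR_matrix_vector_assoc[symmetric] matrix_vector_mult_scaleR)

text \<open>All columns of \<open>M0\<close> and \<open>M1\<close> have sum 1, so the plane of coordinate sum 0 is preserved.\<close>
lemma cell_matrix_plane:
  "(cell_matrix n k *v chord)$1 + (cell_matrix n k *v chord)$2 + (cell_matrix n k *v chord)$3 = 0 \<and>
   (cell_matrix n k *v bend)$1 + (cell_matrix n k *v bend)$2 + (cell_matrix n k *v bend)$3 = 0"
proof (induction n arbitrary: k)
  case 0
  then show ?case by (simp add: chord_def bend_def)
next
  case (Suc n)
  show ?case using Suc.IH[of "k div 2"] unfolding cell_matrix_step by (simp split: if_splits)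
qed

text \<open>
  If \<open>r\<close> is the ratio \<open>q / p\<close>, then a step to the left half replaces it by \<open>3 * (r + 1) / (5 + r)\<close> and a step to
  the right half by \<open>3 * (r - 1) / (5 - r)\<close>. These maps send \<open>[-1,1]\<close> onto \<open>[0,1]\<close> and \<open>[-1,0]\<close>. The second form is
  for a decreasing coordinate, where \<open>p\<close> is negative.
\<close>
lemma cone_step:
  fixes p q :: real
  shows "\<bar>q\<bar> \<le> p \<Longrightarrow> \<bar>3/10 * q + (if b then 3/10 else -3/10) * p\<bar> \<le> 1/2 * p + (if b then 1/10 else -1/10) * q"
    and "\<bar>q\<bar> \<le> - p \<Longrightarrow> \<bar>3/10 * q + (if b then 3/10 else -3/10) * p\<bar> \<le> - (1/2 * p + (if b then 1/10 else -1/10) * q)"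
  unfolding abs_le_iff by (cases b; simp)+

text \<open>
  At level 0 both coordinates lie on the boundary of the cone, with ratios 1 and -1. Their
  difference, from which \<open>mass\<close> and \<open>skew\<close> are formed below, starts on the axis of the cone, with ratio 0.
\<close>
lemma cell_matrix_cone:
  "\<bar>(cell_matrix n k *v bend)$1\<bar> \<le> - (cell_matrix n k *v chord)$1 \<and>
   \<bar>(cell_matrix n k *v bend)$2\<bar> \<le> (cell_matrix n k *v chord)$2"
proof (induction n arbitrary: k)
  case 0
  then show ?case by (simp add: chord_def bend_def)
next
  case (Suc n)
  show ?case unfolding cell_matrix_step vector_add_component vector_scaleR_component real_scaleR_def
    using Suc.IH[of "k div 2"] by (intro conjI cone_step) auto
qed

text \<open>Since \<open>chord\<close> is \<open>u 1 - u 0\<close>, this is the increment of \<open>u$2 - u$1\<close> over the interval.\<close>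
definition mass :: "nat \<Rightarrow> nat \<Rightarrow> real" where
  "mass n k = (cell_matrix n k *v chord)$2 - (cell_matrix n k *v chord)$1"

definition skew :: "nat \<Rightarrow> nat \<Rightarrow> real" where
  "skew n k = (cell_matrix n k *v bend)$2 - (cell_matrix n k *v bend)$1"

lemma mass_Suc: "mass (Suc n) k = mass n (k div 2) / 2 + (if even k then 1 else -1) * skew n (k div 2) / 10"
  and skew_Suc: "skew (Suc n) k = 3/10 * skew n (k div 2) + (if even k then 3/10 else -3/10) * mass n (k div 2)"
  unfolding mass_def skew_def cell_matrix_step by (simp_all add: field_simps)

lemma skew_le_mass: "\<bar>skew n k\<bar> \<le> mass n k"
  using cell_matrix_cone[of n k] unfolding skew_def mass_def by linarith

lemma mass_pos: "mass n k > 0"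
proof (induction n arbitrary: k)
  case 0
  then show ?case by (simp add: mass_def chord_def)
next
  case (Suc n)
  have "mass n (k div 2) > 0" "\<bar>skew n (k div 2)\<bar> \<le> mass n (k div 2)"
    using Suc.IH skew_le_mass by auto
  then show ?case unfolding mass_Suc abs_le_iff by (cases "even k") simp_all
qed

lemma norm_le_two_coords:
  fixes v :: "real^3"
  assumes "v$1 + v$2 + v$3 = 0"
  shows "norm v \<le> 2 * (\<bar>v$1\<bar> + \<bar>v$2\<bar>)"
proof -
  have "v$3 = - (v$1 + v$2)" using assms by linarith
  then have "\<bar>v$3\<bar> \<le> \<bar>v$1\<bar> + \<bar>v$2\<bar>" by (simp only: abs_minus_cancel abs_triangle_ineq)
  then show ?thesis using norm_le_l1_cart[of v] by (simp add: sum_3)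
qed

text \<open>
  The mass is the sum of the absolute increments of the first two coordinates, and the cone
  condition bounds the image of \<open>bend\<close> by the same quantities.
\<close>
lemma norm_le_2_mass:
  "norm (cell_matrix n k *v chord) \<le> 2 * mass n k" "norm (cell_matrix n k *v bend) \<le> 2 * mass n k"
proof -
  let ?p = "cell_matrix n k *v chord" and ?q = "cell_matrix n k *v bend"
  have q: "\<bar>?q$1\<bar> \<le> - ?p$1" "\<bar>?q$2\<bar> \<le> ?p$2" using cell_matrix_cone by auto
  then have p: "\<bar>?p$1\<bar> = - ?p$1" "\<bar>?p$2\<bar> = ?p$2" by linarith+
  show "norm ?p \<le> 2 * mass n k"
    using norm_le_two_coords[of ?p] cell_matrix_plane[of n k] p by (simp add: mass_def)
  have "norm ?q \<le> 2 * (\<bar>?q$1\<bar> + \<bar>?q$2\<bar>)"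
    using norm_le_two_coords[of ?q] cell_matrix_plane[of n k] by blast
  also have "\<dots> \<le> 2 * (- ?p$1 + ?p$2)" using q by (intro mult_left_mono add_mono) auto
  finally show "norm ?q \<le> 2 * mass n k" by (simp add: mass_def)
qed

section \<open>Exponential decay of the typical mass\<close>

text \<open>
  When an interval of skew \<open>y = 0\<close> is divided, both halves get the same mass, and the sum of the square
  roots grows by the full factor \<open>sqrt 2\<close>. But these halves have the skew ratios \<open>3/5\<close> and \<open>-3/5\<close>, so with a small
  penalty for skewness the factor is below \<open>sqrt 2\<close> in every step.
\<close>
definition weight :: "real \<Rightarrow> real \<Rightarrow> real" where
  "weight x y = sqrt x * (1 - (y / x)^2 / 200)"

text \<open>
  Any number below 1 with \<open>2 * \<theta>^2 \<ge> 1.9973\<close> would serve; see the constants in the next lemma.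
\<close>
definition \<theta> :: real where "\<theta> = 9995 / 10000"

text \<open>
  Concavity of the square root gives a gain of \<open>r^2 / 100\<close>, enough to pay for the lower weight of a skewed
  parent, which costs at most \<open>2 * r^2 / 200\<close> on the right-hand side. The penalties of the halves
  give a gain of at least \<open>27/10000\<close> that does not depend on \<open>r\<close>, and this one leaves room for \<open>\<theta> < 1\<close>.
\<close>
lemma weight_contraction_normalized:
  fixes r :: real
  assumes "\<bar>r\<bar> \<le> 1"
  shows "sqrt (1 + r/5) * (1 - (3 * (1 + r) / (5 + r))^2 / 200)
       + sqrt (1 - r/5) * (1 - (3 * (r - 1) / (5 - r))^2 / 200) \<le> 2 * \<theta>^2 * (1 - r^2 / 200)"
proof -
  \<comment> \<open>The penalty of one half; replacing \<open>r\<close> by \<open>-r\<close> exchanges the two halves.\<close>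
  have key: "sqrt (1 + t/5) * (3 * (1 + t) / (5 + t))^2 \<ge> 27/100 * (1 + t)^2" if "\<bar>t\<bar> \<le> 1" for t :: real
  proof -
    define a where "a = sqrt (1 + t/5)"
    have a2: "a^2 = 1 + t/5" and a0: "a > 0" using that by (auto simp: a_def)
    have "a \<le> 11/10" unfolding a_def using that by (intro real_le_lsqrt) (auto simp: power2_eq_square)
    have "a^2 * a \<le> 6/5 * (11/10)" using that \<open>a \<le> 11/10\<close> a0 unfolding a2 by (intro mult_mono) auto
    then have a3: "a^3 * (27/100) \<le> 9/25" by (simp add: power3_eq_cube power2_eq_square)
    have t5: "5 + t = 5 * a^2" using a2 by simp
    have "a * (3 * (1 + t) / (5 + t))^2 = 9/25 * (1 + t)^2 / a^3"
      unfolding t5 using a0 by (simp add: field_simps power2_eq_square power3_eq_cube)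
    also have "\<dots> \<ge> 27/100 * (1 + t)^2"
      using a0 mult_right_mono[OF a3, of "(1+t)^2"] by (simp add: field_simps)
    finally show ?thesis by (simp add: a_def)
  qed
  have k1: "sqrt (1 + r/5) * (3 * (1 + r) / (5 + r))^2 \<ge> 27/100 * (1 + r)^2"
    using key[OF assms] .
  have k2: "sqrt (1 - r/5) * (3 * (r - 1) / (5 - r))^2 \<ge> 27/100 * (1 - r)^2"
    using key[of "-r"] assms by (simp add: power_divide power2_commute[of 3 "3 * r"] right_diff_distrib)
  have r2: "r^2 \<le> 1" using assms by (simp add: abs_square_le_1)
  have sq: "sqrt (1 + r/5) + sqrt (1 - r/5) \<le> 2 - r^2 / 100"
  proof (rule power2_le_imp_le)
    have "sqrt (1 + r/5) * sqrt (1 - r/5) = sqrt (1 - r^2/25)"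
      by (simp add: real_sqrt_mult[symmetric] algebra_simps power2_eq_square)
    also have "\<dots> \<le> 1 - r^2/50"
    proof (rule real_le_lsqrt)
      show "1 - r^2/25 \<le> (1 - r^2/50)^2" by (simp add: power2_diff)
    qed (use r2 in auto)
    finally have "(sqrt (1 + r/5) + sqrt (1 - r/5))^2 \<le> 4 - r^2/25"
      using assms by (simp add: power2_sum)
    also have "\<dots> \<le> (2 - r^2/100)^2" by (simp add: power2_diff)
    finally show "(sqrt (1 + r/5) + sqrt (1 - r/5))^2 \<le> (2 - r^2/100)^2" .
    show "0 \<le> 2 - r^2/100" using r2 by simp
  qed
  have combine: "a * (1 - p / 200) + b * (1 - q / 200) \<le> m - (c + d) / 200"
    if "a * p \<ge> c" "b * q \<ge> d" "a + b \<le> m" for a b c d m p q :: real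
    using that by (simp add: field_simps)
  have "sqrt (1 + r/5) * (1 - (3 * (1 + r) / (5 + r))^2 / 200)
       + sqrt (1 - r/5) * (1 - (3 * (r - 1) / (5 - r))^2 / 200)
       \<le> 2 - r^2/100 - (27/100 * (1 + r)^2 + 27/100 * (1 - r)^2) / 200"
    by (rule combine[OF k1 k2 sq])
  also have "\<dots> = 2 - r^2/100 - 27/20000 * (2 + 2 * r^2)"
  proof -
    have "(1 + r)^2 + (1 - r)^2 = 2 + 2 * r^2" by (simp add: power2_eq_square algebra_simps)
    then show ?thesis by (simp only: distrib_left[symmetric])
  qed
  also have "\<dots> \<le> 2 * \<theta>^2 * (1 - r^2 / 200)"
  proof -
    have th: "2 * \<theta>^2 = 3996001 / 2000000" by (simp add: \<theta>_def power2_eq_square)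
    show ?thesis using r2 unfolding th by (simp add: field_simps)
  qed
  finally show ?thesis .
qed

text \<open>The weight is homogeneous of degree \<open>1/2\<close>, so everything reduces to the ratio \<open>r = y / x\<close>.\<close>
lemma weight_contraction:
  assumes "x > 0" "\<bar>y\<bar> \<le> x"
  shows "weight (x/2 + y/10) (3/10 * y + 3/10 * x) + weight (x/2 - y/10) (3/10 * y - 3/10 * x)
     \<le> (sqrt 2 * \<theta>^2) * weight x y"
proof -
  define r where "r = y / x"
  have y: "y = r * x" using assms by (simp add: r_def)
  have r: "\<bar>r\<bar> \<le> 1" using assms by (simp add: r_def)
  have e: "x/2 + y/10 = x/2 * (1 + r/5)" "x/2 - y/10 = x/2 * (1 - r/5)" by (simp_all add: y field_simps)
  have p: "(3/10 * y + 3/10 * x) / (x/2 + y/10) = 3 * (1 + r) / (5 + r)"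
    "(3/10 * y - 3/10 * x) / (x/2 - y/10) = 3 * (r - 1) / (5 - r)"
  proof -
    have "(3/10 * y + 3/10 * x) = (3 * (1 + r)) * (x/10)" "x/2 + y/10 = (5 + r) * (x/10)"
      "(3/10 * y - 3/10 * x) = (3 * (r - 1)) * (x/10)" "x/2 - y/10 = (5 - r) * (x/10)"
      by (simp_all add: y field_simps)
    then show "(3/10 * y + 3/10 * x) / (x/2 + y/10) = 3 * (1 + r) / (5 + r)"
      "(3/10 * y - 3/10 * x) / (x/2 - y/10) = 3 * (r - 1) / (5 - r)"
      using assms(1) by (simp_all only:) simp_all
  qed
  have "weight (x/2 + y/10) (3/10 * y + 3/10 * x) + weight (x/2 - y/10) (3/10 * y - 3/10 * x)
    = sqrt (x/2) * (sqrt (1 + r/5) * (1 - (3 * (1 + r) / (5 + r))^2 / 200)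
       + sqrt (1 - r/5) * (1 - (3 * (r - 1) / (5 - r))^2 / 200))"
    unfolding weight_def p unfolding e real_sqrt_mult by (simp add: algebra_simps)
  also have "\<dots> \<le> sqrt (x/2) * (2 * \<theta>^2 * (1 - r^2 / 200))"
    using assms weight_contraction_normalized[OF r] by (intro mult_left_mono) auto
  also have "\<dots> = (sqrt 2 * \<theta>^2) * weight x y"
  proof -
    have "sqrt (x/2) * 2 = sqrt 2 * sqrt x"
      by (simp add: real_sqrt_divide field_simps)
    then have "(sqrt (x/2) * 2) * (\<theta>^2 * (1 - r^2 / 200)) = (sqrt 2 * sqrt x) * (\<theta>^2 * (1 - r^2 / 200))"
      by (simp only:)
    then show ?thesis by (simp only: weight_def r_def[symmetric] mult_ac)
  qed
  finally show ?thesis .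
qed

lemma sum_pairs: "(\<Sum>k<2*m. f k) = (\<Sum>k<m. f (2*k) + f (2*k+1))" for f :: "nat \<Rightarrow> real"
  by (induction m) auto

lemma sum_weight_le: "(\<Sum>k<2^n. weight (mass n k) (skew n k)) \<le> sqrt 2 * (sqrt 2 * \<theta>^2)^n"
proof (induction n)
  case 0
  then show ?case by (simp add: weight_def mass_def skew_def chord_def bend_def)
next
  case (Suc n)
  let ?W = "\<lambda>n k. weight (mass n k) (skew n k)"
  have "(\<Sum>k<2^Suc n. ?W (Suc n) k) = (\<Sum>k<2^n. ?W (Suc n) (2*k) + ?W (Suc n) (2*k+1))"
    using sum_pairs[of "?W (Suc n)" "2^n"] by simp
  also have "\<dots> \<le> (\<Sum>k<2^n. (sqrt 2 * \<theta>^2) * ?W n k)"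
    using weight_contraction[OF mass_pos skew_le_mass]
    by (intro sum_mono) (simp add: mass_Suc skew_Suc)
  also have "\<dots> = (sqrt 2 * \<theta>^2) * (\<Sum>k<2^n. ?W n k)" by (simp add: sum_distrib_left)
  also have "\<dots> \<le> (sqrt 2 * \<theta>^2) * (sqrt 2 * (sqrt 2 * \<theta>^2)^n)"
    by (intro mult_left_mono Suc.IH) simp
  finally show ?case by (simp add: mult_ac)
qed

text \<open>
  The square root of the threshold has the factor \<open>\<theta>^n\<close>, only half of the exponential gain \<open>\<theta>^(2*n)\<close> of
  \<open>sum_weight_le\<close>; the other half makes heavy intervals rare.
\<close>
definition heavy :: "nat \<Rightarrow> nat set" where
  "heavy n = {k. k < 2^n \<and> mass n k > \<theta>^(2*n) / 2^n}"

lemma finite_heavy: "finite (heavy n)"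
  by (rule finite_subset[of _ "{..<2^n}"]) (auto simp: heavy_def)

text \<open>
  Markov's inequality: each heavy interval contributes at least \<open>(\<theta> / sqrt 2)^n * (199/200)\<close> to a sum that is
  at most \<open>sqrt 2 * (sqrt 2 * \<theta>^2)^n\<close>.
\<close>
lemma card_heavy_le: "real (card (heavy n)) \<le> 4 * \<theta>^n * 2^n"
proof -
  let ?W = "\<lambda>k. weight (mass n k) (skew n k)"
  have th: "\<theta> > 0" by (simp add: \<theta>_def)
  have W: "?W k \<ge> sqrt (mass n k) * (199/200)" for k
  proof -
    have "\<bar>skew n k / mass n k\<bar> \<le> 1" using skew_le_mass[of n k] mass_pos[of n k] by simp
    then have "(skew n k / mass n k)^2 \<le> 1" by (simp only: abs_square_le_1)
    then show ?thesis unfolding weight_def using mass_pos[of n k] by (intro mult_left_mono) auto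
  qed
  have W0: "?W k \<ge> 0" for k
    using order_trans[OF _ W[of k]] mass_pos[of n k] by simp
  have s: "sqrt (\<theta>^(2*n) / 2^n) = \<theta>^n / sqrt 2^n"
    using th by (simp add: real_sqrt_divide real_sqrt_power power_mult)
  have "real (card (heavy n)) * (\<theta>^n / sqrt 2^n * (199/200)) = (\<Sum>k\<in>heavy n. \<theta>^n / sqrt 2^n * (199/200))"
    by simp
  also have "\<dots> \<le> (\<Sum>k\<in>heavy n. ?W k)"
  proof (rule sum_mono)
    fix k assume "k \<in> heavy n"
    then have "sqrt (\<theta>^(2*n) / 2^n) \<le> sqrt (mass n k)" by (auto simp: heavy_def)
    then have "\<theta>^n / sqrt 2^n * (199/200) \<le> sqrt (mass n k) * (199/200)"
      unfolding s by (rule mult_right_mono) simp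
    then show "\<theta>^n / sqrt 2^n * (199/200) \<le> ?W k" using W[of k] by (rule order_trans)
  qed
  also have "\<dots> \<le> (\<Sum>k<2^n. ?W k)"
    using W0 by (intro sum_mono2) (auto simp: heavy_def)
  also have "\<dots> \<le> sqrt 2 * (sqrt 2 * \<theta>^2)^n" by (rule sum_weight_le)
  also have "\<dots> = sqrt 2 * (200/199) * (\<theta>^n * 2^n) * (\<theta>^n / sqrt 2^n * (199/200))"
  proof -
    have two: "(2::real)^n = sqrt 2^n * sqrt 2^n" by (simp flip: power_mult_distrib)
    have th2: "(\<theta>^2)^n = \<theta>^n * \<theta>^n" by (simp add: power2_eq_square power_mult_distrib)
    have "a * (w * (q * q)) = a * (200/199) * (q * (w * w)) * (q / w * (199/200))" if "w \<noteq> 0" for a q w :: real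
      using that by simp
    then show ?thesis unfolding power_mult_distrib two th2 by simp
  qed
  finally have "real (card (heavy n)) \<le> sqrt 2 * (200/199) * (\<theta>^n * 2^n)"
    by (rule mult_right_le_imp_le) (use th in simp)
  also have "\<dots> \<le> 4 * (\<theta>^n * 2^n)"
    using th sqrt2_less_2 by (intro mult_right_mono) auto
  finally show ?thesis by simp
qed

text \<open>
  The intervals are enlarged by both neighbours: a point close to \<open>s\<close> may lie in an adjacent dyadic
  interval whose matrix has little to do with the one for \<open>s\<close>.
\<close>
lemma AE_avoids_heavy:
  "AE s in lebesgue. eventually (\<lambda>n. \<forall>k\<in>heavy n. s \<notin> {(real k - 1) / 2^n .. (real k + 2) / 2^n}) sequentially"
proof -
  define J where "J n k = {(real k - 1) / 2^n .. (real k + 2) / 2^n}" for n k :: nat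
  define B where "B n = (\<Union>k\<in>heavy n. J n k)" for n
  have Jm: "J n k \<in> lmeasurable" for n k by (simp add: J_def)
  have Bm: "B n \<in> lmeasurable" for n
    unfolding B_def using finite_heavy Jm by (intro fmeasurable.finite_UN) auto
  have mJ: "measure lebesgue (J n k) = 3 / 2^n" for n k
    by (simp add: J_def divide_right_mono diff_divide_distrib[symmetric])
  have mB: "measure lebesgue (B n) \<le> 12 * \<theta>^n" for n
  proof -
    have "measure lebesgue (B n) \<le> (\<Sum>k\<in>heavy n. measure lebesgue (J n k))"
      unfolding B_def by (rule measure_UNION_le) (use finite_heavy Jm in auto)
    also have "\<dots> = real (card (heavy n)) * (3 / 2^n)" by (simp add: mJ)
    also have "\<dots> \<le> (4 * \<theta>^n * 2^n) * (3 / 2^n)" by (intro mult_right_mono card_heavy_le) auto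
    finally show ?thesis by simp
  qed
  have "AE s in lebesgue. eventually (\<lambda>n. s \<in> space lebesgue - B n) sequentially"
  proof (rule borel_cantelli_AE1)
    show "B n \<in> sets lebesgue" for n using Bm by auto
    show "emeasure lebesgue (B n) < \<infinity>" for n using fmeasurableD2[OF Bm[of n]] by (simp add: top.not_eq_extremum)
    show "summable (\<lambda>n. measure lebesgue (B n))"
    proof (rule summable_comparison_test')
      show "summable (\<lambda>n. 12 * \<theta>^n)" by (intro summable_mult summable_geometric) (simp add: \<theta>_def)
      show "norm (measure lebesgue (B n)) \<le> 12 * \<theta>^n" for n using mB[of n] by simp
    qed
  qed
  then show ?thesis by (rule AE_mp) (auto simp: B_def J_def intro!: AE_I2 elim!: eventually_mono)
qed

section \<open>Increments of the curve\<close>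

text \<open>
  The coordinate sum of \<open>u\<close> does not change under \<open>x \<mapsto> x / 2\<close>; by continuity it equals its value at 0.
\<close>
lemma curve_sum_coords:
  assumes "is_curve u" "x \<in> {0..1}"
  shows "u x $ 1 + u x $ 2 + u x $ 3 = 1"
proof -
  define S where "S v = v$1 + v$2 + v$3" for v :: "real^3"
  have M: "S (M0 *v v) = S v" for v by (simp add: S_def M0_mult)
  have D: "S (u (x / 2^n)) = S (u x) \<and> x / 2^n \<in> {0..1}" for n
  proof (induction n)
    case (Suc n)
    have "u (h0 (x / 2^n)) = M0 *v u (x / 2^n)" using Suc assms(1) unfolding is_curve_def by blast
    then show ?case using Suc M by (auto simp: h0_def field_simps)
  qed (use assms in auto)
  have "(\<lambda>n. x * (1/2)^n) \<longlonglongrightarrow> x * 0"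
    by (intro tendsto_intros LIMSEQ_power_zero) auto
  then have "(\<lambda>n. x / 2^n) \<longlonglongrightarrow> 0" by (simp add: power_one_over)
  moreover have "continuous_on {0..1} u" using assms by (auto simp: is_curve_def)
  ultimately have "(\<lambda>n. u (x / 2^n)) \<longlonglongrightarrow> u 0"
    using D by (intro continuous_on_tendsto_compose[of "{0..1}" u]) auto
  then have "(\<lambda>n. S (u (x / 2^n))) \<longlonglongrightarrow> S (u 0)"
    unfolding S_def by (intro tendsto_add tendsto_vec_nth)
  then have "(\<lambda>n. S (u x)) \<longlonglongrightarrow> S (u 0)" using D by simp
  then have "S (u x) = S (u 0)" by (simp add: LIMSEQ_const_iff)
  then show ?thesis using assms(1) by (simp add: S_def is_curve_def)
qed

text \<open>
  On \<open>[0,1]\<close> the increments of \<open>u\<close> are combinations of \<open>chord\<close> and \<open>bend\<close> with bounded coefficients, and the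
  matrix of an interval maps both vectors to vectors of norm at most \<open>2 * mass\<close>.
\<close>
lemma oscillation_le_mass:
  assumes "is_curve u"
  obtains C where "C > 0"
    "\<And>n k s t. k < 2^n \<Longrightarrow> s \<in> cell n k \<Longrightarrow> t \<in> cell n k \<Longrightarrow> norm (u s - u t) \<le> C * mass n k"
proof -
  have "compact (u ` {0..1})"
    using assms by (intro compact_continuous_image) (auto simp: is_curve_def)
  then obtain B where "B > 0" "\<forall>v\<in>u ` {0..1}. norm v \<le> B"
    using compact_imp_bounded bounded_pos by blast
  then have B: "B > 0" "\<And>x. x \<in> {0..1} \<Longrightarrow> norm (u x) \<le> B" by auto
  have "norm (u s - u t) \<le> (8 * B) * mass n k" if k: "k < 2^n" and st: "s \<in> cell n k" "t \<in> cell n k" for n k s t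
  proof -
    have par: "\<exists>x\<in>{0..1}. s = (real k + x) / 2^n" if "s \<in> cell n k" for s
      using that by (intro bexI[of _ "s * 2^n - real k"]) (auto simp: cell_def field_simps)
    obtain x where x: "x \<in> {0..1}" "s = (real k + x) / 2^n" using par[OF st(1)] by blast
    obtain z where z: "z \<in> {0..1}" "t = (real k + z) / 2^n" using par[OF st(2)] by blast
    define v where "v = u x - u z"
    define a b where "a = (v$2 - v$1) / 2" and "b = v$3 / 2"
    have "v$1 + v$2 + v$3 = 0"
      using curve_sum_coords[OF assms x(1)] curve_sum_coords[OF assms z(1)] by (simp add: v_def)
    \<comment> \<open>\<open>a\<close> and \<open>b\<close> are the coordinates of \<open>v\<close> in the basis \<open>chord\<close>, \<open>bend\<close> of the plane.\<close>
    then have v: "v = a *\<^sub>R chord + b *\<^sub>R bend"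
      by (simp add: a_def b_def chord_def bend_def vec_eq_iff forall_3 field_simps)
    have nv: "norm v \<le> 2 * B"
      using norm_triangle_ineq4[of "u x" "u z"] B(2)[OF x(1)] B(2)[OF z(1)] by (simp add: v_def)
    have "\<bar>v$i\<bar> \<le> 2 * B" for i
      using component_le_norm_cart[of v i] nv by linarith
    from this[of 1] this[of 2] this[of 3] have ab: "\<bar>a\<bar> \<le> 2 * B" "\<bar>b\<bar> \<le> 2 * B"
      unfolding a_def b_def by (simp_all add: abs_le_iff)
    let ?A = "cell_matrix n k"
    have "u s - u t = ?A *v v"
      unfolding x(2) z(2) v_def using curve_on_cell[OF assms k] x(1) z(1)
      by (simp add: matrix_vector_mult_diff_distrib)
    also have "\<dots> = a *\<^sub>R (?A *v chord) + b *\<^sub>R (?A *v bend)"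
      unfolding v by (simp add: matrix_vector_right_distrib matrix_vector_mult_scaleR)
    also have "norm \<dots> \<le> \<bar>a\<bar> * norm (?A *v chord) + \<bar>b\<bar> * norm (?A *v bend)"
      by (rule norm_triangle_le) simp
    also have "\<dots> \<le> 2 * B * (2 * mass n k) + 2 * B * (2 * mass n k)"
      using ab norm_le_2_mass[of n k] B(1) by (intro add_mono mult_mono) auto
    finally show ?thesis by simp
  qed
  then show thesis using that[of "8 * B"] B(1) by auto
qed

text \<open>
  The point \<open>p\<close> allows the increment from \<open>s\<close> to \<open>t\<close> to be split into one increment within each interval:
  it is \<open>t\<close> itself or the common endpoint of two adjacent intervals.
\<close>
lemma close_points_in_touching_cells:
  fixes s t :: real
  assumes "s \<in> {0..1}" "t \<in> {0..1}" "s \<le> t" "t - s \<le> 1 / 2^n"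
  obtains j k p where "j < 2^n" "k < 2^n" "s \<in> cell n j" "t \<in> cell n k" "p \<in> cell n j" "p \<in> cell n k"
proof -
  have ex: "\<exists>k<2^n. x \<in> cell n k" if x: "x \<in> {0..1}" for x
  proof (cases "x = 1")
    case True
    \<comment> \<open>The endpoint 1 belongs to the last interval although its integer part at level \<open>n\<close> is \<open>2^n\<close>.\<close>
    then show ?thesis by (intro exI[of _ "2^n - 1"]) (auto simp: cell_def of_nat_diff)
  next
    case False
    define k where "k = nat \<lfloor>x * 2^n\<rfloor>"
    have k: "real k \<le> x * 2^n" "x * 2^n < real k + 1"
      using x unfolding k_def by (auto simp: of_nat_nat)
    have "x * 2^n < 2^n" using x False by auto
    with k(1) have "real k < 2^n" by (rule le_less_trans)
    then have "k < 2^n" using of_nat_less_iff[of k "2^n", where 'a=real] by simp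
    then show ?thesis using k by (intro exI[of _ k]) (auto simp: cell_def field_simps)
  qed
  obtain j where j: "j < 2^n" "s \<in> cell n j" using ex assms by blast
  obtain k where k: "k < 2^n" "t \<in> cell n k" using ex assms by blast
  show thesis
  proof (cases "t \<le> (real j + 1) / 2^n")
    case True
    then have "t \<in> cell n j" using j assms(3) by (auto simp: cell_def)
    then show thesis using that[of j k t] j k by blast
  next
    case False
    have s': "real j \<le> s * 2^n" "s * 2^n \<le> real j + 1" using j by (auto simp: cell_def field_simps)
    have t': "real j + 1 < t * 2^n" "t * 2^n \<le> s * 2^n + 1" using False assms(4) by (auto simp: field_simps)
    have "t * 2^n \<le> 2^n" using assms(2) by auto
    then have "real j + 1 < 2^n" using t'(1) by linarith
    then have "real (j + 1) < 2^n" by simp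
    then have "j + 1 < 2^n" using of_nat_less_iff[of "j + 1" "2^n", where 'a=real] by simp
    moreover have "t \<in> cell n (j + 1)" "(real j + 1) / 2^n \<in> cell n j" "(real j + 1) / 2^n \<in> cell n (j + 1)"
      using s' t' by (auto simp: cell_def field_simps)
    ultimately show thesis using that[of j "j + 1" "(real j + 1) / 2^n"] j by blast
  qed
qed

text \<open>
  Both intervals met between \<open>s\<close> and \<open>t\<close> contain \<open>s\<close> after enlargement by their neighbours, so
  neither of them is heavy.
\<close>
lemma increment_le:
  fixes s t :: real
  assumes C: "C > 0"
    "\<And>n k s t. k < 2^n \<Longrightarrow> s \<in> cell n k \<Longrightarrow> t \<in> cell n k \<Longrightarrow> norm (u s - u t) \<le> C * mass n k"
    and st: "s \<in> {0..1}" "t \<in> {0..1}" "\<bar>t - s\<bar> \<le> 1 / 2^n"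
    and av: "\<And>k. k \<in> heavy n \<Longrightarrow> s \<notin> {(real k - 1) / 2^n .. (real k + 2) / 2^n}"
  shows "norm (u t - u s) \<le> 2 * C * (\<theta>^(2*n) / 2^n)"
proof -
  obtain j k p where jk: "j < 2^n" "k < 2^n" "s \<in> cell n j" "t \<in> cell n k" "p \<in> cell n j" "p \<in> cell n k"
  proof (cases "s \<le> t")
    case True
    then show ?thesis using close_points_in_touching_cells[of s t n] st that by auto
  next
    case False
    then show ?thesis using close_points_in_touching_cells[of t s n] st that by auto
  qed
  have "s \<in> {(real j - 1) / 2^n .. (real j + 2) / 2^n}" using jk(3) by (auto simp: cell_def field_simps)
  then have mj: "mass n j \<le> \<theta>^(2*n) / 2^n" using av[of j] jk(1) by (force simp: heavy_def)
  have "s \<in> {(real k - 1) / 2^n .. (real k + 2) / 2^n}" using jk(4) st(3) by (auto simp: cell_def field_simps abs_le_iff)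
  then have mk: "mass n k \<le> \<theta>^(2*n) / 2^n" using av[of k] jk(2) by (force simp: heavy_def)
  have "norm (u t - u s) \<le> norm (u t - u p) + norm (u p - u s)"
    using norm_triangle_ineq[of "u t - u p" "u p - u s"] by simp
  also have "\<dots> \<le> C * mass n k + C * mass n j"
    by (intro add_mono C jk)
  also have "\<dots> \<le> C * (\<theta>^(2*n) / 2^n) + C * (\<theta>^(2*n) / 2^n)"
    using C(1) mj mk by (intro add_mono mult_left_mono) auto
  finally show ?thesis by simp
qed

lemma dyadic_scale:
  fixes d :: real
  assumes "0 < d" "d \<le> 1 / 2^N"
  obtains n where "n \<ge> N" "1 / 2^Suc n < d" "d \<le> 1 / 2^n"
proof -
  obtain m where m: "(1/2)^m < d" using real_arch_pow_inv[OF assms(1), of "1/2"] by auto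
  define M where "M = (LEAST m. 1 / 2^m < d)"
  have ex: "1 / 2^m < d" using m by (simp add: power_one_over)
  have M: "1 / 2^M < d" unfolding M_def by (rule LeastI[of _ m], rule ex)
  have NM: "N < M"
  proof (rule ccontr)
    assume "\<not> N < M"
    then have "(2::real)^M \<le> 2^N" by (intro power_increasing) auto
    then have "1 / 2^N \<le> 1 / (2::real)^M" by (simp add: field_simps)
    then show False using M assms(2) by linarith
  qed
  then obtain n where n: "M = Suc n" by (cases M) auto
  then have "\<not> 1 / 2^n < d" unfolding M_def using not_less_Least by (metis lessI)
  then show thesis using that[of n] M NM n by auto
qed

section \<open>Vanishing of the derivative\<close>

theorem corollary17:
  fixes u :: "real \<Rightarrow> real^3"
  assumes "is_curve u"
  shows "AE s in lebesgue. s \<in> {0..1} \<longrightarrow> (u has_vector_derivative 0) (at s within {0..1})"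
proof -
  obtain C where C: "C > 0"
    "\<And>n k s t. k < 2^n \<Longrightarrow> s \<in> cell n k \<Longrightarrow> t \<in> cell n k \<Longrightarrow> norm (u s - u t) \<le> C * mass n k"
    using oscillation_le_mass[OF assms] by blast
  have "(u has_vector_derivative 0) (at s within {0..1})"
    if s: "s \<in> {0..1}"
      and ev: "eventually (\<lambda>n. \<forall>k\<in>heavy n. s \<notin> {(real k - 1) / 2^n .. (real k + 2) / 2^n}) sequentially" for s
    unfolding has_vector_derivative_def has_derivative_within_alt
  proof (intro conjI allI impI)
    show "bounded_linear (\<lambda>x. x *\<^sub>R (0::real^3))" by simp
    fix e :: real assume e: "e > 0"
    have "(\<lambda>n. 4 * C * (\<theta>^2)^n) \<longlonglongrightarrow> 4 * C * 0"
      by (intro tendsto_intros LIMSEQ_power_zero) (simp add: \<theta>_def power2_eq_square)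
    then have "eventually (\<lambda>n. 4 * C * (\<theta>^2)^n < e) sequentially"
      using e by (auto intro: order_tendstoD)
    with ev obtain N where N: "\<And>n k. n \<ge> N \<Longrightarrow> k \<in> heavy n \<Longrightarrow> s \<notin> {(real k - 1) / 2^n .. (real k + 2) / 2^n}"
      "\<And>n. n \<ge> N \<Longrightarrow> 4 * C * (\<theta>^2)^n < e"
      using eventually_conj[OF ev \<open>eventually (\<lambda>n. 4 * C * (\<theta>^2)^n < e) sequentially\<close>]
      unfolding eventually_sequentially by blast
    have "norm (u t - u s - (t - s) *\<^sub>R 0) \<le> e * norm (t - s)"
      if t: "t \<in> {0..1}" "norm (t - s) < 1 / 2^N" for t
    proof (cases "t = s")
      case False
      then obtain n where n: "n \<ge> N" "1 / 2^Suc n < \<bar>t - s\<bar>" "\<bar>t - s\<bar> \<le> 1 / 2^n"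
        using dyadic_scale[of "\<bar>t - s\<bar>" N] t(2) by auto
      \<comment> \<open>As \<open>n\<close> is the scale of \<open>t - s\<close>, the bound \<open>2^-n\<close> costs at most a factor 2 in the difference quotient.\<close>
      have "norm (u t - u s) \<le> 2 * C * (\<theta>^(2*n) / 2^n)"
        using increment_le[where u = u, OF C s t(1) n(3) N(1)[OF n(1)]] by blast
      also have "\<dots> = 4 * C * (\<theta>^2)^n * (1 / 2^Suc n)" by (simp add: power_mult)
      also have "\<dots> \<le> e * \<bar>t - s\<bar>"
        using N(2)[OF n(1)] n(2) C(1) e by (intro mult_mono) auto
      finally show ?thesis by simp
    qed simp
    then show "\<exists>d>0. \<forall>t\<in>{0..1}. norm (t - s) < d \<longrightarrow> norm (u t - u s - (t - s) *\<^sub>R 0) \<le> e * norm (t - s)"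
      by (intro exI[of _ "1 / 2^N"]) auto
  qed
  then have "s \<in> {0..1} \<longrightarrow> (u has_vector_derivative 0) (at s within {0..1})"
    if "eventually (\<lambda>n. \<forall>k\<in>heavy n. s \<notin> {(real k - 1) / 2^n .. (real k + 2) / 2^n}) sequentially" for s
    using that by blast
  with AE_avoids_heavy show ?thesis by (rule eventually_mono)
qed

end
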